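(* Let $(B,g_B)$ and $(F,g_F)$ be singular semi-Riemannian manifolds, $b:B\times F\to\mathbb R$ smooth, $P\in\Gamma(TF)$, and $\overline{\mathcal K}$ the semi-symmetric metric Koszul form, with respect to $P$, of the (possibly degenerate) twisted product $B\times_bF$. For all $X,Y,Z\in\Gamma(TB)$ and $U,V,W\in\Gamma(TF)$: (1) $\overline{\mathcal K}(X,Y,Z)=\mathcal K_B(X,Y,Z)$; (2) $\overline{\mathcal K}(X,Y,W)=-\overline{\mathcal K}(X,W,Y)=-b^2g_B(X,Y)g_F(P,W)$; (3) $\overline{\mathcal K}(W,X,Y)=0$; (4) $\overline{\mathcal K}(X,V,W)=\overline{\mathcal K}(V,X,W)=-\overline{\mathcal K}(V,W,X)=bX(b)g_F(V,W)$; (5) $\overline{\mathcal K}(U,V,W)=bU(b)g_F(V,W)+bV(b)g_F(W,U)-bW(b)g_F(U,V)+b^2\mathcal K_F(U,V,W)+b^4g_F(V,P)g_F(U,W)-b^4g_F(W,P)g_F(U,V)$.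
   Context: A singular semi-Riemannian manifold $(M,g)$ is a smooth manifold with a smooth symmetric bilinear form $g$ on $TM$, possibly degenerate and of variable signature. Its Koszul form is $\mathcal K(X,Y,Z)=\frac12\{X(g(Y,Z))+Y(g(Z,X))-Z(g(X,Y))-g(X,[Y,Z])+g(Y,[Z,X])+g(Z,[X,Y])\}$. For a vector field $P$ on $M$, the semi-symmetric metric Koszul form is $\overline{\mathcal K}(X,Y,Z)=\mathcal K(X,Y,Z)+g(Y,P)g(X,Z)-g(X,Y)g(P,Z)$. The twisted product $B\times_bF$ with twisting function $b:B\times F\to\mathbb R$ (smooth, possibly vanishing) is $B\times F$ with $g=\pi_B^*(g_B)+b^2\pi_F^*(g_F)$, $\pi_B,\pi_F$ the canonical projections. Vector fields in $\Gamma(TB)$, $\Gamma(TF)$ are identified with their lifts to the product, and functions and tensors on the factors with their pullbacks. Subscripts $B$, $F$ denote (lifts of) objects of that factor. *)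

theory Defs
  imports "HOL-Analysis.Analysis"
begin

section \<open>Smooth manifolds\<close>

text \<open>Class \<open>C\<^sup>k\<close> on an open subset of a finite-dimensional normed space: the directional
  derivatives in all (constant) directions exist and are again of class \<open>C\<^sup>k\<^sup>-\<^sup>1\<close>.
  In infinite dimensions this recursion would not be the usual notion.\<close>

primrec Ck_on :: "nat \<Rightarrow> 'e::real_normed_vector set \<Rightarrow> ('e \<Rightarrow> 'f::real_normed_vector) \<Rightarrow> bool" where
  "Ck_on 0 S f \<longleftrightarrow> continuous_on S f"
| "Ck_on (Suc k) S f \<longleftrightarrow> (\<forall>x\<in>S. f differentiable (at x)) \<and>
     (\<forall>v. Ck_on k S (\<lambda>x. frechet_derivative f (at x) v))"

definition smooth_on :: "'e::real_normed_vector set \<Rightarrow> ('e \<Rightarrow> 'f::real_normed_vector) \<Rightarrow> bool" where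
  "smooth_on S f \<longleftrightarrow> (\<forall>k. Ck_on k S f)"

text \<open>A chart is a pair of a domain and a coordinate map; the values of the coordinate map
  outside the domain are irrelevant. The underlying set of a manifold is the whole type.
  An atlas need not be maximal.\<close>

type_synonym ('a, 'e) atlas = "('a set \<times> ('a \<Rightarrow> 'e)) set"

text \<open>The model space is an arbitrary finite-dimensional normed space rather than a type of class
  \<open>euclidean_space\<close>, because the latter would exclude manifolds of dimension 0.\<close>

definition smooth_manifold ::
  "('a::{t2_space, second_countable_topology}, 'e::real_normed_vector) atlas \<Rightarrow> bool" where
  "smooth_manifold A \<longleftrightarrow>
     (\<exists>B::'e set. finite B \<and> span B = UNIV) \<and>
     (\<forall>(U, \<phi>)\<in>A. open U \<and> open (\<phi> ` U) \<and> homeomorphism U (\<phi> ` U) \<phi> (inv_into U \<phi>)) \<and>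
     (\<Union>(U, \<phi>)\<in>A. U) = UNIV \<and>
     (\<forall>(U, \<phi>)\<in>A. \<forall>(V, \<psi>)\<in>A. smooth_on (\<phi> ` (U \<inter> V)) (\<psi> \<circ> inv_into U \<phi>))"

definition smooth_fun :: "('a, 'e::real_normed_vector) atlas \<Rightarrow> ('a \<Rightarrow> real) \<Rightarrow> bool" where
  "smooth_fun A f \<longleftrightarrow> (\<forall>(U, \<phi>)\<in>A. smooth_on (\<phi> ` U) (f \<circ> inv_into U \<phi>))"

section \<open>Tangent vectors and vector fields\<close>

text \<open>Tangent vectors are derivations of the algebra of smooth functions. A derivation is
  represented as a total functional that is 0 on functions which are not smooth, so that equal
  derivations are equal functionals.\<close>

type_synonym 'a tangent = "('a \<Rightarrow> real) \<Rightarrow> real"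

definition tangent_space :: "('a, 'e::real_normed_vector) atlas \<Rightarrow> 'a \<Rightarrow> 'a tangent set" where
  "tangent_space A p = {v.
     (\<forall>f h. smooth_fun A f \<longrightarrow> smooth_fun A h \<longrightarrow> v (\<lambda>x. f x + h x) = v f + v h) \<and>
     (\<forall>c f. smooth_fun A f \<longrightarrow> v (\<lambda>x. c * f x) = c * v f) \<and>
     (\<forall>f h. smooth_fun A f \<longrightarrow> smooth_fun A h \<longrightarrow> v (\<lambda>x. f x * h x) = f p * v h + h p * v f) \<and>
     (\<forall>f. \<not> smooth_fun A f \<longrightarrow> v f = 0)}"

type_synonym 'a vfield = "'a \<Rightarrow> 'a tangent"

definition vector_fields :: "('a, 'e::real_normed_vector) atlas \<Rightarrow> 'a vfield set" where
  "vector_fields A = {X. (\<forall>p. X p \<in> tangent_space A p) \<and>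
     (\<forall>f. smooth_fun A f \<longrightarrow> smooth_fun A (\<lambda>p. X p f))}"

definition vf_apply :: "'a vfield \<Rightarrow> ('a \<Rightarrow> real) \<Rightarrow> 'a \<Rightarrow> real" where
  "vf_apply X f = (\<lambda>p. X p f)"

definition lie_bracket :: "'a vfield \<Rightarrow> 'a vfield \<Rightarrow> 'a vfield" where
  "lie_bracket X Y = (\<lambda>p f. X p (vf_apply Y f) - Y p (vf_apply X f))"

text \<open>The differential (push-forward of tangent vectors) of a smooth map into the manifold with
  atlas \<open>A\<close>; the base point is implicit in the tangent vector.\<close>

definition differential ::
  "('b, 'e::real_normed_vector) atlas \<Rightarrow> ('a \<Rightarrow> 'b) \<Rightarrow> 'a tangent \<Rightarrow> 'b tangent" where
  "differential A \<Phi> v = (\<lambda>f. if smooth_fun A f then v (f \<circ> \<Phi>) else 0)"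

section \<open>Singular semi-Riemannian manifolds\<close>

type_synonym 'a metric = "'a \<Rightarrow> 'a tangent \<Rightarrow> 'a tangent \<Rightarrow> real"

definition singular_semi_riemannian ::
  "('a::{t2_space, second_countable_topology}, 'e::real_normed_vector) atlas \<Rightarrow> 'a metric \<Rightarrow> bool" where
  "singular_semi_riemannian A g \<longleftrightarrow> smooth_manifold A \<and>
     (\<forall>p. \<forall>u\<in>tangent_space A p. \<forall>v\<in>tangent_space A p. g p u v = g p v u) \<and>
     (\<forall>p. \<forall>u\<in>tangent_space A p. \<forall>v\<in>tangent_space A p. \<forall>w\<in>tangent_space A p.
        g p (\<lambda>f. u f + v f) w = g p u w + g p v w) \<and>
     (\<forall>p. \<forall>c. \<forall>u\<in>tangent_space A p. \<forall>w\<in>tangent_space A p.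
        g p (\<lambda>f. c * u f) w = c * g p u w) \<and>
     (\<forall>X\<in>vector_fields A. \<forall>Y\<in>vector_fields A. smooth_fun A (\<lambda>p. g p (X p) (Y p)))"

definition metric_fun :: "'a metric \<Rightarrow> 'a vfield \<Rightarrow> 'a vfield \<Rightarrow> 'a \<Rightarrow> real" where
  "metric_fun g X Y = (\<lambda>p. g p (X p) (Y p))"

definition koszul :: "'a metric \<Rightarrow> 'a vfield \<Rightarrow> 'a vfield \<Rightarrow> 'a vfield \<Rightarrow> 'a \<Rightarrow> real" where
  "koszul g X Y Z = (\<lambda>p. 1/2 *
     (vf_apply X (metric_fun g Y Z) p + vf_apply Y (metric_fun g Z X) p
        - vf_apply Z (metric_fun g X Y) p
        - metric_fun g X (lie_bracket Y Z) p + metric_fun g Y (lie_bracket Z X) p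
        + metric_fun g Z (lie_bracket X Y) p))"

definition semi_symmetric_koszul ::
  "'a metric \<Rightarrow> 'a vfield \<Rightarrow> 'a vfield \<Rightarrow> 'a vfield \<Rightarrow> 'a vfield \<Rightarrow> 'a \<Rightarrow> real" where
  "semi_symmetric_koszul g P X Y Z = (\<lambda>p. koszul g X Y Z p
     + metric_fun g Y P p * metric_fun g X Z p - metric_fun g X Y p * metric_fun g P Z p)"

section \<open>Twisted products\<close>

definition prod_atlas ::
  "('a, 'e::real_normed_vector) atlas \<Rightarrow> ('b, 'f::real_normed_vector) atlas \<Rightarrow> ('a \<times> 'b, 'e \<times> 'f) atlas" where
  "prod_atlas A A' = {(U \<times> V, map_prod \<phi> \<psi>) | U \<phi> V \<psi>. (U, \<phi>) \<in> A \<and> (V, \<psi>) \<in> A'}"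

text \<open>The lift of a vector field on a factor is tangent to the slices \<open>B \<times> {y}\<close>
  (respectively \<open>{x} \<times> F\<close>): it is the push-forward along the slice inclusions.\<close>

definition lift_base ::
  "('a, 'e::real_normed_vector) atlas \<Rightarrow> ('b, 'f::real_normed_vector) atlas \<Rightarrow> 'a vfield \<Rightarrow> ('a \<times> 'b) vfield" where
  "lift_base A A' X = (\<lambda>(x, y). differential (prod_atlas A A') (\<lambda>x'. (x', y)) (X x))"

definition lift_fibre ::
  "('a, 'e::real_normed_vector) atlas \<Rightarrow> ('b, 'f::real_normed_vector) atlas \<Rightarrow> 'b vfield \<Rightarrow> ('a \<times> 'b) vfield" where
  "lift_fibre A A' V = (\<lambda>(x, y). differential (prod_atlas A A') (\<lambda>y'. (x, y')) (V y))"

definition twisted_metric ::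
  "('a, 'e::real_normed_vector) atlas \<Rightarrow> 'a metric \<Rightarrow> ('b, 'f::real_normed_vector) atlas \<Rightarrow> 'b metric
     \<Rightarrow> ('a \<times> 'b \<Rightarrow> real) \<Rightarrow> ('a \<times> 'b) metric" where
  "twisted_metric A g A' g' b = (\<lambda>p v w.
     g (fst p) (differential A fst v) (differential A fst w)
     + (b p)\<^sup>2 * g' (snd p) (differential A' snd v) (differential A' snd w))"

end

theory Submission
  imports Defs
begin

text \<open>
  A lift from the base projects to a field on \<open>B\<close> and to the zero field on \<open>F\<close>; a lift from the
  fibre does the opposite. All five formulas are therefore specialisations of one identity for
  fields \<open>E\<^sub>i\<close> on \<open>B \<times> F\<close> with projections \<open>X\<^sub>i\<close> and \<open>U\<^sub>i\<close> (\<open>koszul_twisted_projectable\<close>),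
  \<open>K(E\<^sub>1, E\<^sub>2, E\<^sub>3) = K\<^sub>B(X\<^sub>1, X\<^sub>2, X\<^sub>3) + b\<^sup>2 K\<^sub>F(U\<^sub>1, U\<^sub>2, U\<^sub>3)
     + b E\<^sub>1(b) g\<^sub>F(U\<^sub>2, U\<^sub>3) + b E\<^sub>2(b) g\<^sub>F(U\<^sub>3, U\<^sub>1) - b E\<^sub>3(b) g\<^sub>F(U\<^sub>1, U\<^sub>2)\<close>,
  in which every term with a zero field as an argument drops out. The terms that involve \<open>P\<close> are
  products of values of the metric and split in the same way.

  The identity has two ingredients. Brackets of projectable fields project to the brackets of the
  projections (\<open>lie_bracket_projects_to\<close>), so each bracket term splits into a base and a fibre part.
  And a product field differentiates \<open>g\<^sub>B(X, Y) + b\<^sup>2 g\<^sub>F(U, V)\<close> by the Leibniz rule, which produces the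
  terms with derivatives of \<open>b\<close>.

  The rest concerns smoothness. A derivation is by convention 0 on functions that are not smooth,
  so the Leibniz rule and the evaluation of lifts are available only once sums, products, pullbacks
  under the projections and restrictions to slices are known to be smooth. In product charts the
  projections and the slice inclusions are affine, which makes the chain rule for affine maps
  (\<open>Ck_on_compose_affine\<close>) sufficient. The metric sees a tangent vector of the product only
  through its action on functions pulled back from a factor, and on these a lift acts as the original
  field does, with results that are pullbacks again.
\<close>

section \<open>Smooth functions in coordinates\<close>

lemma Ck_on_cong:
  assumes "open S" "Ck_on k S f" "\<And>x. x \<in> S \<Longrightarrow> f x = g x"
  shows "Ck_on k S g"
  using assms(2,3)
proof (induction k arbitrary: f g)
  case 0
  then show ?case
    by (simp cong: continuous_on_cong)
next
  case (Suc k)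
  have deriv: "(g has_derivative frechet_derivative f (at x)) (at x)" if "x \<in> S" for x
  proof (rule has_derivative_transform_within_open[OF _ \<open>open S\<close> that Suc.prems(2)])
    show "(f has_derivative frechet_derivative f (at x)) (at x)"
      using Suc.prems(1) that by (simp flip: frechet_derivative_works)
  qed
  have eq: "frechet_derivative f (at x) = frechet_derivative g (at x)" if "x \<in> S" for x
    using deriv[OF that] by (rule frechet_derivative_at)
  have "Ck_on k S (\<lambda>x. frechet_derivative g (at x) v)" for v
    by (rule Suc.IH[of "\<lambda>x. frechet_derivative f (at x) v"]) (use Suc.prems(1) in \<open>auto simp: eq\<close>)
  with deriv show ?case
    by (auto simp: differentiable_def)
qed

lemma Ck_on_SucI:
  assumes "open S" "\<And>x. x \<in> S \<Longrightarrow> (f has_derivative f' x) (at x)"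
    and "\<And>v. Ck_on k S (\<lambda>x. f' x v)"
  shows "Ck_on (Suc k) S f"
proof -
  have eq: "f' x = frechet_derivative f (at x)" if "x \<in> S" for x
    using assms(2)[OF that] by (rule frechet_derivative_at)
  have "Ck_on k S (\<lambda>x. frechet_derivative f (at x) v)" for v
    by (rule Ck_on_cong[OF \<open>open S\<close> assms(3)[of v]]) (simp add: eq)
  with assms(2) show ?thesis
    by (auto simp: differentiable_def)
qed

lemma Ck_on_Suc_derivative:
  assumes "Ck_on (Suc k) S f" "x \<in> S"
  shows "(f has_derivative frechet_derivative f (at x)) (at x)"
  using assms by (simp flip: frechet_derivative_works)

lemma Ck_on_Suc_imp: "Ck_on (Suc k) S f \<Longrightarrow> Ck_on k S f"
proof (induction k arbitrary: f)
  case 0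
  then show ?case
    by (auto intro!: continuous_at_imp_continuous_on differentiable_imp_continuous_within)
next
  case (Suc k)
  then show ?case
    by (metis Ck_on.simps(2))
qed

lemma Ck_on_const:
  assumes "open S"
  shows "Ck_on k S (\<lambda>x. c)"
proof (induction k arbitrary: c)
  case (Suc k)
  show ?case
    using Suc.IH by (intro Ck_on_SucI[OF assms, of _ "\<lambda>_ _. 0"]) simp_all
qed simp

lemma Ck_on_add:
  assumes "open S" "Ck_on k S f" "Ck_on k S g"
  shows "Ck_on k S (\<lambda>x. f x + g x)"
  using assms(2,3)
proof (induction k arbitrary: f g)
  case 0
  then show ?case
    by (simp add: continuous_on_add)
next
  case (Suc k)
  show ?case
  proof (rule Ck_on_SucI[OF \<open>open S\<close>])
    show "((\<lambda>x. f x + g x) has_derivative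
        (\<lambda>v. frechet_derivative f (at x) v + frechet_derivative g (at x) v)) (at x)" if "x \<in> S" for x
      using Suc.prems that by (intro has_derivative_add Ck_on_Suc_derivative)
    show "Ck_on k S (\<lambda>x. frechet_derivative f (at x) v + frechet_derivative g (at x) v)" for v
      using Suc.prems by (intro Suc.IH) auto
  qed
qed

lemma Ck_on_mult:
  fixes f g :: "'e::real_normed_vector \<Rightarrow> 'a::real_normed_algebra"
  assumes "open S" "Ck_on k S f" "Ck_on k S g"
  shows "Ck_on k S (\<lambda>x. f x * g x)"
  using assms(2,3)
proof (induction k arbitrary: f g)
  case 0
  then show ?case
    by (simp add: continuous_on_mult)
next
  case (Suc k)
  show ?case
  proof (rule Ck_on_SucI[OF \<open>open S\<close>])
    show "((\<lambda>x. f x * g x) has_derivative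
        (\<lambda>v. f x * frechet_derivative g (at x) v + frechet_derivative f (at x) v * g x)) (at x)"
      if "x \<in> S" for x
      using Suc.prems that by (intro has_derivative_mult Ck_on_Suc_derivative)
    \<comment> \<open>The factors that are not differentiated have to be lowered from order \<open>k + 1\<close> to \<open>k\<close>.\<close>
    show "Ck_on k S (\<lambda>x. f x * frechet_derivative g (at x) v + frechet_derivative f (at x) v * g x)" for v
      using Suc.prems Suc.prems[THEN Ck_on_Suc_imp] by (intro Ck_on_add \<open>open S\<close> Suc.IH) auto
  qed
qed

text \<open>For an affine inner map the derivative of the composite, in a fixed direction, is again a
  composite with that same affine map, so the induction closes without a product rule.\<close>

lemma Ck_on_compose_affine:
  assumes "open T" "bounded_linear l" "\<And>x. x \<in> T \<Longrightarrow> l x + c \<in> S" "Ck_on k S f"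
  shows "Ck_on k T (\<lambda>x. f (l x + c))"
  using assms(4)
proof (induction k arbitrary: f)
  case 0
  then show ?case
    using assms(3)
    by (auto intro!: continuous_on_compose2[of S f] continuous_intros
        bounded_linear.continuous_on[OF assms(2)])
next
  case (Suc k)
  show ?case
  proof (rule Ck_on_SucI[OF \<open>open T\<close>])
    show "((\<lambda>x. f (l x + c)) has_derivative (\<lambda>v. frechet_derivative f (at (l x + c)) (l v))) (at x)"
      if "x \<in> T" for x
    proof (rule has_derivative_compose[of "\<lambda>x. l x + c" l])
      show "((\<lambda>x. l x + c) has_derivative l) (at x)"
        using bounded_linear_imp_has_derivative[OF assms(2)] by (auto intro!: derivative_eq_intros)
      show "(f has_derivative frechet_derivative f (at (l x + c))) (at (l x + c))"
        using Suc.prems assms(3)[OF that] by (rule Ck_on_Suc_derivative)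
    qed
    show "Ck_on k T (\<lambda>x. frechet_derivative f (at (l x + c)) (l v))" for v
      using Suc.prems by (intro Suc.IH[of "\<lambda>y. frechet_derivative f (at y) (l v)"]) simp
  qed
qed

section \<open>Smooth functions on manifolds and products\<close>

text \<open>The part of the manifold axioms on which the algebra of smooth functions rests, in a form
  that passes to product atlases chart by chart.\<close>

definition covering_atlas :: "('a, 'e::real_normed_vector) atlas \<Rightarrow> bool" where
  "covering_atlas A \<longleftrightarrow> (\<forall>(U, \<phi>)\<in>A. open (\<phi> ` U) \<and> inj_on \<phi> U) \<and> (\<Union>(U, \<phi>)\<in>A. U) = UNIV"

lemma covering_atlasD:
  assumes "covering_atlas A" "(U, \<phi>) \<in> A"
  shows "open (\<phi> ` U)" "inj_on \<phi> U"
  using assms by (auto simp: covering_atlas_def)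

lemma covering_atlas_chart:
  assumes "covering_atlas A"
  obtains U \<phi> where "(U, \<phi>) \<in> A" "p \<in> U"
proof -
  have "p \<in> (\<Union>(U, \<phi>)\<in>A. U)"
    using assms by (simp add: covering_atlas_def)
  then show ?thesis
    using that by auto
qed

lemma smooth_manifold_imp_covering_atlas:
  assumes "smooth_manifold A"
  shows "covering_atlas A"
proof -
  have "inj_on \<phi> U" if "homeomorphism U (\<phi> ` U) \<phi> (inv_into U \<phi>)" for U and \<phi> :: "'a \<Rightarrow> 'b"
    using that unfolding homeomorphism_def by (metis inj_onI)
  then show ?thesis
    using assms by (auto simp: smooth_manifold_def covering_atlas_def split_beta)
qed

lemma covering_atlas_prod_atlas:
  assumes "covering_atlas A" "covering_atlas A'"
  shows "covering_atlas (prod_atlas A A')"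
  unfolding covering_atlas_def
proof (intro conjI)
  have "open (map_prod \<phi> \<psi> ` (U \<times> V)) \<and> inj_on (map_prod \<phi> \<psi>) (U \<times> V)"
    if "(U, \<phi>) \<in> A" "(V, \<psi>) \<in> A'" for U \<phi> V \<psi>
    using covering_atlasD[OF assms(1) that(1)] covering_atlasD[OF assms(2) that(2)]
    by (simp add: map_prod_surj_on[OF refl refl] open_Times map_prod_inj_on)
  then show "\<forall>(U, \<phi>)\<in>prod_atlas A A'. open (\<phi> ` U) \<and> inj_on \<phi> U"
    by (auto simp: prod_atlas_def)
  have "\<exists>(U, \<phi>)\<in>prod_atlas A A'. (x, y) \<in> U" for x y
  proof -
    obtain U \<phi> V \<psi> where "(U, \<phi>) \<in> A" "x \<in> U" "(V, \<psi>) \<in> A'" "y \<in> V"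
      using covering_atlas_chart assms by metis
    then show ?thesis
      by (intro bexI[of _ "(U \<times> V, map_prod \<phi> \<psi>)"]) (auto simp: prod_atlas_def)
  qed
  then show "(\<Union>(U, \<phi>)\<in>prod_atlas A A'. U) = UNIV"
    by fast
qed

lemma smooth_fun_const:
  assumes "covering_atlas A"
  shows "smooth_fun A (\<lambda>x. c)"
  using assms by (auto simp: smooth_fun_def smooth_on_def comp_def intro!: Ck_on_const dest: covering_atlasD)

lemma smooth_fun_add:
  assumes "covering_atlas A" "smooth_fun A f" "smooth_fun A h"
  shows "smooth_fun A (\<lambda>x. f x + h x)"
  using assms by (fastforce simp: smooth_fun_def smooth_on_def comp_def intro!: Ck_on_add dest: covering_atlasD)

lemma smooth_fun_mult:
  assumes "covering_atlas A" "smooth_fun A f" "smooth_fun A h"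
  shows "smooth_fun A (\<lambda>x. f x * h x)"
  using assms by (fastforce simp: smooth_fun_def smooth_on_def comp_def intro!: Ck_on_mult dest: covering_atlasD)

text \<open>The chart of the target may depend on the chart of the source only: one chart must contain the
  whole image of \<open>U\<close>. Product charts make
  this true of projections and slice inclusions.\<close>

lemma smooth_fun_compose_affine:
  assumes "covering_atlas A" "covering_atlas A'" "smooth_fun A' f"
    and affine: "\<And>U \<phi>. (U, \<phi>) \<in> A \<Longrightarrow> \<exists>V \<psi> l c. (V, \<psi>) \<in> A' \<and> bounded_linear l \<and>
          (\<forall>p\<in>U. \<Phi> p \<in> V \<and> \<psi> (\<Phi> p) = l (\<phi> p) + c)"
  shows "smooth_fun A (f \<circ> \<Phi>)"
  unfolding smooth_fun_def smooth_on_def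
proof (safe)
  fix U \<phi> k
  assume U: "(U, \<phi>) \<in> A"
  then obtain V \<psi> l c where V: "(V, \<psi>) \<in> A'" and l: "bounded_linear l"
    and eq: "\<And>p. p \<in> U \<Longrightarrow> \<Phi> p \<in> V" "\<And>p. p \<in> U \<Longrightarrow> l (\<phi> p) + c = \<psi> (\<Phi> p)"
    using affine by metis
  note charts = covering_atlasD[OF assms(1) U] covering_atlasD[OF assms(2) V]
  have "Ck_on k (\<psi> ` V) (f \<circ> inv_into V \<psi>)"
    using assms(3) V by (auto simp: smooth_fun_def smooth_on_def)
  then have "Ck_on k (\<phi> ` U) (\<lambda>x. (f \<circ> inv_into V \<psi>) (l x + c))"
    by (rule Ck_on_compose_affine[OF charts(1) l, rotated]) (auto simp: eq)
  then show "Ck_on k (\<phi> ` U) (f \<circ> \<Phi> \<circ> inv_into U \<phi>)"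
    by (rule Ck_on_cong[OF charts(1)]) (auto simp: eq charts(2,4))
qed

context
  fixes A :: "('a, 'e::real_normed_vector) atlas" and A' :: "('b, 'f::real_normed_vector) atlas"
  assumes A: "covering_atlas A" and A': "covering_atlas A'"
begin

lemma smooth_fun_comp_fst:
  assumes "smooth_fun A f"
  shows "smooth_fun (prod_atlas A A') (f \<circ> fst)"
proof (rule smooth_fun_compose_affine[OF covering_atlas_prod_atlas[OF A A'] A assms])
  fix W \<theta> assume "(W, \<theta>) \<in> prod_atlas A A'"
  then obtain U \<phi> V \<psi> where "(U, \<phi>) \<in> A" "W = U \<times> V" "\<theta> = map_prod \<phi> \<psi>"
    by (auto simp: prod_atlas_def)
  then show "\<exists>V \<psi> l c. (V, \<psi>) \<in> A \<and> bounded_linear l \<and> (\<forall>p\<in>W. fst p \<in> V \<and> \<psi> (fst p) = l (\<theta> p) + c)"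
    by (intro exI[of _ U] exI[of _ \<phi>] exI[of _ fst] exI[of _ 0]) (auto simp: bounded_linear_fst)
qed

lemma smooth_fun_comp_snd:
  assumes "smooth_fun A' f"
  shows "smooth_fun (prod_atlas A A') (f \<circ> snd)"
proof (rule smooth_fun_compose_affine[OF covering_atlas_prod_atlas[OF A A'] A' assms])
  fix W \<theta> assume "(W, \<theta>) \<in> prod_atlas A A'"
  then obtain U \<phi> V \<psi> where "(V, \<psi>) \<in> A'" "W = U \<times> V" "\<theta> = map_prod \<phi> \<psi>"
    by (auto simp: prod_atlas_def)
  then show "\<exists>V \<psi> l c. (V, \<psi>) \<in> A' \<and> bounded_linear l \<and> (\<forall>p\<in>W. snd p \<in> V \<and> \<psi> (snd p) = l (\<theta> p) + c)"
    by (intro exI[of _ V] exI[of _ \<psi>] exI[of _ snd] exI[of _ 0]) (auto simp: bounded_linear_snd)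
qed

lemma smooth_fun_slice_base:
  assumes "smooth_fun (prod_atlas A A') f"
  shows "smooth_fun A (f \<circ> (\<lambda>x. (x, y)))"
proof (rule smooth_fun_compose_affine[OF A covering_atlas_prod_atlas[OF A A'] assms])
  fix U \<phi> assume U: "(U, \<phi>) \<in> A"
  obtain V \<psi> where V: "(V, \<psi>) \<in> A'" "y \<in> V"
    by (rule covering_atlas_chart[OF A'])
  show "\<exists>W \<theta> l c. (W, \<theta>) \<in> prod_atlas A A' \<and> bounded_linear l \<and>
      (\<forall>p\<in>U. (p, y) \<in> W \<and> \<theta> (p, y) = l (\<phi> p) + c)"
    using U V
    by (intro exI[of _ "U \<times> V"] exI[of _ "map_prod \<phi> \<psi>"] exI[of _ "\<lambda>e. (e, 0)"] exI[of _ "(0, \<psi> y)"])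
      (auto simp: prod_atlas_def intro!: bounded_linear_Pair bounded_linear_ident bounded_linear_zero)
qed

lemma smooth_fun_slice_fibre:
  assumes "smooth_fun (prod_atlas A A') f"
  shows "smooth_fun A' (f \<circ> (\<lambda>y. (x, y)))"
proof (rule smooth_fun_compose_affine[OF A' covering_atlas_prod_atlas[OF A A'] assms])
  fix V \<psi> assume V: "(V, \<psi>) \<in> A'"
  obtain U \<phi> where U: "(U, \<phi>) \<in> A" "x \<in> U"
    by (rule covering_atlas_chart[OF A])
  show "\<exists>W \<theta> l c. (W, \<theta>) \<in> prod_atlas A A' \<and> bounded_linear l \<and>
      (\<forall>p\<in>V. (x, p) \<in> W \<and> \<theta> (x, p) = l (\<psi> p) + c)"
    using U V
    by (intro exI[of _ "U \<times> V"] exI[of _ "map_prod \<phi> \<psi>"] exI[of _ "\<lambda>e. (0, e)"] exI[of _ "(\<phi> x, 0)"])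
      (auto simp: prod_atlas_def intro!: bounded_linear_Pair bounded_linear_ident bounded_linear_zero)
qed

end

section \<open>Tangent vectors and brackets\<close>

lemma tangent_spaceD:
  assumes "v \<in> tangent_space A p"
  shows tangent_add: "smooth_fun A f \<Longrightarrow> smooth_fun A h \<Longrightarrow> v (\<lambda>x. f x + h x) = v f + v h"
    and tangent_scale: "smooth_fun A f \<Longrightarrow> v (\<lambda>x. c * f x) = c * v f"
    and tangent_mult: "smooth_fun A f \<Longrightarrow> smooth_fun A h \<Longrightarrow> v (\<lambda>x. f x * h x) = f p * v h + h p * v f"
    and tangent_not_smooth: "\<not> smooth_fun A f \<Longrightarrow> v f = 0"
  using assms by (auto simp: tangent_space_def)

lemma tangent_const:
  assumes "covering_atlas A" "v \<in> tangent_space A p"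
  shows "v (\<lambda>x. c) = 0"
  using tangent_scale[OF assms(2) smooth_fun_const[OF assms(1), of 1], of c]
    tangent_mult[OF assms(2) smooth_fun_const[OF assms(1), of 1] smooth_fun_const[OF assms(1), of 1]]
  by simp

lemma vector_fieldsD:
  assumes "X \<in> vector_fields A"
  shows vector_field_tangent: "X p \<in> tangent_space A p"
    and vector_field_smooth: "smooth_fun A f \<Longrightarrow> smooth_fun A (vf_apply X f)"
  using assms by (auto simp: vector_fields_def vf_apply_def)

abbreviation zero_field :: "'a vfield" where
  "zero_field \<equiv> \<lambda>_ _. 0"

lemma zero_tangent: "(\<lambda>_. 0) \<in> tangent_space A p"
  by (simp add: tangent_space_def)

lemma zero_field_vector_field:
  assumes "covering_atlas A"
  shows "zero_field \<in> vector_fields A"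
  by (simp add: vector_fields_def zero_tangent smooth_fun_const assms)

lemma lie_bracket_zero:
  assumes "covering_atlas A" "X \<in> vector_fields A"
  shows "lie_bracket X zero_field = zero_field" "lie_bracket zero_field X = zero_field"
  using tangent_const[OF assms(1) vector_field_tangent[OF assms(2)]]
  by (auto simp: lie_bracket_def vf_apply_def fun_eq_iff)

text \<open>Brackets respect the convention that tangent vectors vanish on functions that are not smooth: the
  inner field already sends such a function to the constant 0.\<close>

lemma lie_bracket_not_smooth:
  assumes "covering_atlas A" "X \<in> vector_fields A" "Y \<in> vector_fields A" "\<not> smooth_fun A f"
  shows "lie_bracket X Y p f = 0"
  using assms
  by (simp add: lie_bracket_def vf_apply_def tangent_not_smooth[OF vector_field_tangent]
      tangent_const[OF _ vector_field_tangent])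

lemma lie_bracket_tangent:
  assumes A: "covering_atlas A" and X: "X \<in> vector_fields A" and Y: "Y \<in> vector_fields A"
  shows "lie_bracket X Y p \<in> tangent_space A p"
proof -
  note tX = vector_field_tangent[OF X] and tY = vector_field_tangent[OF Y]
    and sX = vector_field_smooth[OF X] and sY = vector_field_smooth[OF Y]
  have add: "vf_apply Z (\<lambda>x. f x + h x) = (\<lambda>p. vf_apply Z f p + vf_apply Z h p)"
    and scale: "vf_apply Z (\<lambda>x. c * f x) = (\<lambda>p. c * vf_apply Z f p)"
    and mult: "vf_apply Z (\<lambda>x. f x * h x) = (\<lambda>p. f p * vf_apply Z h p + h p * vf_apply Z f p)"
    if "Z \<in> vector_fields A" "smooth_fun A f" "smooth_fun A h" for Z f h c
    using that by (simp_all add: vf_apply_def tangent_add[OF vector_field_tangent[OF that(1)]]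
        tangent_scale[OF vector_field_tangent[OF that(1)]] tangent_mult[OF vector_field_tangent[OF that(1)]])
  have "lie_bracket X Y p (\<lambda>x. f x + h x) = lie_bracket X Y p f + lie_bracket X Y p h"
    if "smooth_fun A f" "smooth_fun A h" for f h
    using that by (simp add: lie_bracket_def add X Y tangent_add[OF tX] tangent_add[OF tY] sX sY)
  moreover have "lie_bracket X Y p (\<lambda>x. c * f x) = c * lie_bracket X Y p f" if "smooth_fun A f" for f c
    using that by (simp add: lie_bracket_def scale X Y tangent_scale[OF tX] tangent_scale[OF tY] sX sY
        right_diff_distrib)
  moreover have "lie_bracket X Y p (\<lambda>x. f x * h x) = f p * lie_bracket X Y p h + h p * lie_bracket X Y p f"
    if "smooth_fun A f" "smooth_fun A h" for f h
    using that by (simp add: lie_bracket_def mult X Y tangent_add[OF tX] tangent_add[OF tY]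
        tangent_mult[OF tX] tangent_mult[OF tY] sX sY smooth_fun_mult[OF A])
      (simp add: vf_apply_def algebra_simps)
  ultimately show ?thesis
    using lie_bracket_not_smooth[OF A X Y] by (simp add: tangent_space_def)
qed

lemma lie_bracket_vector_field:
  assumes A: "covering_atlas A" and X: "X \<in> vector_fields A" and Y: "Y \<in> vector_fields A"
  shows "lie_bracket X Y \<in> vector_fields A"
proof -
  have "smooth_fun A (\<lambda>p. vf_apply X (vf_apply Y f) p + (- 1) * vf_apply Y (vf_apply X f) p)"
    if "smooth_fun A f" for f
    using that by (intro smooth_fun_add smooth_fun_mult smooth_fun_const A vector_field_smooth[OF X]
        vector_field_smooth[OF Y])
  then have "smooth_fun A (\<lambda>p. lie_bracket X Y p f)" if "smooth_fun A f" for f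
    using that by (simp add: lie_bracket_def vf_apply_def)
  then show ?thesis
    by (simp add: vector_fields_def lie_bracket_tangent[OF A X Y])
qed

lemma differential_tangent:
  assumes "v \<in> tangent_space A p" "covering_atlas A'"
    and "\<And>f. smooth_fun A' f \<Longrightarrow> smooth_fun A (f \<circ> \<Phi>)"
  shows "differential A' \<Phi> v \<in> tangent_space A' (\<Phi> p)"
  using assms(3) smooth_fun_const[OF assms(2)] smooth_fun_add[OF assms(2)] smooth_fun_mult[OF assms(2)]
    tangent_add[OF assms(1), of "_ \<circ> \<Phi>" "_ \<circ> \<Phi>"] tangent_scale[OF assms(1), of "_ \<circ> \<Phi>"]
    tangent_mult[OF assms(1), of "_ \<circ> \<Phi>" "_ \<circ> \<Phi>"]
  by (auto simp: tangent_space_def differential_def comp_def)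

lemma differential_comp:
  assumes "\<And>f. smooth_fun A' f \<Longrightarrow> smooth_fun A (f \<circ> \<Phi>)"
  shows "differential A' \<Phi> (differential A \<Psi> v) = differential A' (\<Phi> \<circ> \<Psi>) v"
  using assms by (auto simp: differential_def fun_eq_iff comp_assoc)

lemma differential_ident:
  assumes "v \<in> tangent_space A p"
  shows "differential A (\<lambda>x. x) v = v"
  using tangent_not_smooth[OF assms] by (auto simp: differential_def fun_eq_iff comp_def)

lemma differential_const:
  assumes "covering_atlas A" "v \<in> tangent_space A p"
  shows "differential A' (\<lambda>x. c) v = (\<lambda>_. 0)"
  using tangent_const[OF assms] by (auto simp: differential_def fun_eq_iff comp_def)

text \<open>The push-forward of a vector tests it only on functions \<open>f \<circ> \<Phi>\<close>. On these \<open>Y'\<close> acts as \<open>Y\<close>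
  does on \<open>f\<close>, and the result \<open>Y f \<circ> \<Phi>\<close> is again a pullback, to which the relation for \<open>X'\<close>
  applies. This is why only the fields on the target have to preserve smoothness.\<close>

lemma lie_bracket_related:
  assumes A: "covering_atlas A" and X: "X \<in> vector_fields A" and Y: "Y \<in> vector_fields A"
    and X': "\<And>p. differential A \<Phi> (X' p) = X (\<Phi> p)"
    and Y': "\<And>p. differential A \<Phi> (Y' p) = Y (\<Phi> p)"
  shows "differential A \<Phi> (lie_bracket X' Y' p) = lie_bracket X Y (\<Phi> p)"
proof
  have pull: "Z' q (f \<circ> \<Phi>) = Z (\<Phi> q) f"
    if "\<And>p. differential A \<Phi> (Z' p) = Z (\<Phi> p)" "smooth_fun A f" for Z' Z q f
    using fun_cong[OF that(1)[of q], of f] that(2) by (simp add: differential_def)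
  then have pull_vf: "vf_apply Z' (f \<circ> \<Phi>) = vf_apply Z f \<circ> \<Phi>"
    if "\<And>p. differential A \<Phi> (Z' p) = Z (\<Phi> p)" "smooth_fun A f" for Z' Z f
    using that by (simp add: vf_apply_def comp_def fun_eq_iff)
  fix f
  show "differential A \<Phi> (lie_bracket X' Y' p) f = lie_bracket X Y (\<Phi> p) f"
  proof (cases "smooth_fun A f")
    case True
    then show ?thesis
      using pull[of X' X, OF X' vector_field_smooth[OF Y True]] pull[of Y' Y, OF Y' vector_field_smooth[OF X True]]
      by (simp add: differential_def lie_bracket_def pull_vf[of X' X, OF X'] pull_vf[of Y' Y, OF Y'])
  next
    case False
    then show ?thesis
      by (simp add: differential_def lie_bracket_not_smooth[OF A X Y])
  qed
qed

section \<open>Projectable fields on a product\<close>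

definition projects_to ::
  "('a, 'e::real_normed_vector) atlas \<Rightarrow> ('b, 'f::real_normed_vector) atlas
     \<Rightarrow> ('a \<times> 'b) vfield \<Rightarrow> 'a vfield \<Rightarrow> 'b vfield \<Rightarrow> bool" where
  "projects_to A A' E X U \<longleftrightarrow>
     (\<forall>p. differential A fst (E p) = X (fst p) \<and> differential A' snd (E p) = U (snd p))"

text \<open>Upstairs only pointwise tangency is demanded: it carries the Leibniz rule, and it can be read off from
  the definition of a lift.\<close>

definition projectable ::
  "('a, 'e::real_normed_vector) atlas \<Rightarrow> ('b, 'f::real_normed_vector) atlas
     \<Rightarrow> ('a \<times> 'b) vfield \<Rightarrow> 'a vfield \<Rightarrow> 'b vfield \<Rightarrow> bool" where
  "projectable A A' E X U \<longleftrightarrow> projects_to A A' E X U \<and>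
     X \<in> vector_fields A \<and> U \<in> vector_fields A' \<and> (\<forall>p. E p \<in> tangent_space (prod_atlas A A') p)"

lemma projects_toD:
  assumes "projects_to A A' E X U"
  shows "differential A fst (E p) = X (fst p)" "differential A' snd (E p) = U (snd p)"
  using assms by (simp_all add: projects_to_def del: split_paired_All)

lemma projectableD:
  assumes "projectable A A' E X U"
  shows "X \<in> vector_fields A" "U \<in> vector_fields A'"
    and "E p \<in> tangent_space (prod_atlas A A') p" "projects_to A A' E X U"
  using assms by (simp_all add: projectable_def del: split_paired_All)

lemma lie_bracket_projects_to:
  assumes "covering_atlas A" "covering_atlas A'"
    and E: "projectable A A' E X U" and F: "projectable A A' F Y V"
  shows "projects_to A A' (lie_bracket E F) (lie_bracket X Y) (lie_bracket U V)"
  unfolding projects_to_def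
  using projects_toD[OF projectableD(4)[OF E]] projects_toD[OF projectableD(4)[OF F]]
    projectableD(1,2)[OF E] projectableD(1,2)[OF F]
  by (intro allI conjI lie_bracket_related assms)

context
  fixes A :: "('a, 'e::real_normed_vector) atlas" and A' :: "('b, 'f::real_normed_vector) atlas"
  assumes A: "covering_atlas A" and A': "covering_atlas A'"
begin

lemma projectable_lift_base:
  assumes X: "X \<in> vector_fields A"
  shows "projectable A A' (lift_base A A' X) X zero_field"
proof -
  have "lift_base A A' X (x, y) \<in> tangent_space (prod_atlas A A') (x, y)
      \<and> differential A fst (lift_base A A' X (x, y)) = X x
      \<and> differential A' snd (lift_base A A' X (x, y)) = (\<lambda>_. 0)" for x y
  proof -
    note v = vector_field_tangent[OF X, of x]
    show ?thesis
      using differential_tangent[OF v covering_atlas_prod_atlas[OF A A'], of "\<lambda>x. (x, y)",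
          OF smooth_fun_slice_base[OF A A']]
      by (simp add: lift_base_def differential_comp[OF smooth_fun_comp_fst[OF A A']]
          differential_comp[OF smooth_fun_comp_snd[OF A A']] comp_def
          differential_ident[OF v] differential_const[OF A v])
  qed
  then show ?thesis
    by (simp add: projectable_def projects_to_def X zero_field_vector_field A')
qed

lemma projectable_lift_fibre:
  assumes U: "U \<in> vector_fields A'"
  shows "projectable A A' (lift_fibre A A' U) zero_field U"
proof -
  have "lift_fibre A A' U (x, y) \<in> tangent_space (prod_atlas A A') (x, y)
      \<and> differential A fst (lift_fibre A A' U (x, y)) = (\<lambda>_. 0)
      \<and> differential A' snd (lift_fibre A A' U (x, y)) = U y" for x y
  proof -
    note v = vector_field_tangent[OF U, of y]
    show ?thesis
      using differential_tangent[OF v covering_atlas_prod_atlas[OF A A'], of "\<lambda>y. (x, y)",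
          OF smooth_fun_slice_fibre[OF A A']]
      by (simp add: lift_fibre_def differential_comp[OF smooth_fun_comp_fst[OF A A']]
          differential_comp[OF smooth_fun_comp_snd[OF A A']] comp_def
          differential_ident[OF v] differential_const[OF A' v])
  qed
  then show ?thesis
    by (simp add: projectable_def projects_to_def U zero_field_vector_field A)
qed

end

section \<open>The Koszul form of a singular metric\<close>

lemma singular_semi_riemannianD:
  assumes "singular_semi_riemannian A g"
  shows singular_covering_atlas: "covering_atlas A"
    and singular_sym: "u \<in> tangent_space A p \<Longrightarrow> v \<in> tangent_space A p \<Longrightarrow> g p u v = g p v u"
    and singular_scale: "u \<in> tangent_space A p \<Longrightarrow> v \<in> tangent_space A p \<Longrightarrow> g p (\<lambda>f. c * u f) v = c * g p u v"
    and singular_smooth: "X \<in> vector_fields A \<Longrightarrow> Y \<in> vector_fields A \<Longrightarrow> smooth_fun A (metric_fun g X Y)"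
  using assms
  by (auto simp: singular_semi_riemannian_def metric_fun_def intro: smooth_manifold_imp_covering_atlas)

lemma singular_zero:
  assumes "singular_semi_riemannian A g" "u \<in> tangent_space A p"
  shows "g p (\<lambda>_. 0) u = 0" "g p u (\<lambda>_. 0) = 0"
proof -
  show "g p (\<lambda>_. 0) u = 0"
    using singular_scale[OF assms(1) zero_tangent assms(2), of 0] by simp
  then show "g p u (\<lambda>_. 0) = 0"
    using singular_sym[OF assms(1) zero_tangent assms(2)] by simp
qed

lemma metric_fun_sym:
  assumes "singular_semi_riemannian A g" "X \<in> vector_fields A" "Y \<in> vector_fields A"
  shows "metric_fun g X Y = metric_fun g Y X"
  using assms by (simp add: metric_fun_def fun_eq_iff singular_sym vector_field_tangent)

lemma metric_fun_zero:
  assumes "singular_semi_riemannian A g" "X \<in> vector_fields A"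
  shows "metric_fun g zero_field X = (\<lambda>_. 0)" "metric_fun g X zero_field = (\<lambda>_. 0)"
  using singular_zero[OF assms(1) vector_field_tangent[OF assms(2)]] by (simp_all add: metric_fun_def)

lemma koszul_zero:
  assumes g: "singular_semi_riemannian A g" and X: "X \<in> vector_fields A" and Y: "Y \<in> vector_fields A"
  shows "koszul g zero_field X Y = (\<lambda>_. 0)"
    and "koszul g X zero_field Y = (\<lambda>_. 0)"
    and "koszul g X Y zero_field = (\<lambda>_. 0)"
proof -
  note A = singular_covering_atlas[OF g]
  note tX = vector_field_tangent[OF X] and tY = vector_field_tangent[OF Y]
  note rules = koszul_def vf_apply_def fun_eq_iff lie_bracket_zero[OF A X] lie_bracket_zero[OF A Y]
    metric_fun_zero[OF g X] metric_fun_zero[OF g Y] metric_fun_zero[OF g lie_bracket_vector_field[OF A X Y]]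
    metric_fun_zero[OF g lie_bracket_vector_field[OF A Y X]] tangent_const[OF A tX] tangent_const[OF A tY]
  show "koszul g zero_field X Y = (\<lambda>_. 0)" "koszul g X zero_field Y = (\<lambda>_. 0)"
    "koszul g X Y zero_field = (\<lambda>_. 0)"
    by (simp_all add: rules)
qed

section \<open>The Koszul form of a twisted product\<close>

lemma metric_fun_twisted:
  assumes "projects_to A A' E X U" "projects_to A A' F Y V"
  shows "metric_fun (twisted_metric A g A' g' b) E F p
    = metric_fun g X Y (fst p) + (b p)\<^sup>2 * metric_fun g' U V (snd p)"
  using projects_toD[OF assms(1)] projects_toD[OF assms(2)]
  by (simp add: metric_fun_def twisted_metric_def)

text \<open>In the Koszul formula the bracket terms contribute no derivative of \<open>b\<close>, since the factor
  \<open>b\<^sup>2\<close> stays outside the bracket. Each of the three derivative terms contributes a summand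
  \<open>2 b E(b) g'\<close>, which the leading \<open>1/2\<close> turns into \<open>b E(b) g'\<close>.\<close>

lemma koszul_twisted_projectable:
  assumes g: "singular_semi_riemannian A g" and g': "singular_semi_riemannian A' g'"
    and b: "smooth_fun (prod_atlas A A') b"
    and E\<^sub>1: "projectable A A' E\<^sub>1 X U" and E\<^sub>2: "projectable A A' E\<^sub>2 Y V"
    and E\<^sub>3: "projectable A A' E\<^sub>3 Z W"
  shows "koszul (twisted_metric A g A' g' b) E\<^sub>1 E\<^sub>2 E\<^sub>3 p
    = koszul g X Y Z (fst p) + (b p)\<^sup>2 * koszul g' U V W (snd p)
      + b p * vf_apply E\<^sub>1 b p * metric_fun g' V W (snd p)
      + b p * vf_apply E\<^sub>2 b p * metric_fun g' W U (snd p)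
      - b p * vf_apply E\<^sub>3 b p * metric_fun g' U V (snd p)"
proof -
  let ?g = "twisted_metric A g A' g' b"
  note A = singular_covering_atlas[OF g] and A' = singular_covering_atlas[OF g']
  note AA = covering_atlas_prod_atlas[OF A A']
  have deriv: "vf_apply E (metric_fun ?g F G) p
      = vf_apply X (metric_fun g Y Z) (fst p) + (b p)\<^sup>2 * vf_apply U (metric_fun g' V W) (snd p)
        + 2 * b p * vf_apply E b p * metric_fun g' V W (snd p)"
    if E: "projectable A A' E X U" and F: "projectable A A' F Y V" and G: "projectable A A' G Z W"
    for E F G X Y Z U V W
  proof -
    let ?h = "metric_fun g Y Z" and ?h' = "metric_fun g' V W"
    have h: "smooth_fun A ?h" and h': "smooth_fun A' ?h'"
      using projectableD(1,2)[OF F] projectableD(1,2)[OF G] by (auto intro: singular_smooth g g')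
    note t = projectableD(3)[OF E, of p]
    have h_proj: "E p (?h \<circ> fst) = X (fst p) ?h" and h'_proj: "E p (?h' \<circ> snd) = U (snd p) ?h'"
      using h h' by (simp_all add: differential_def flip: projects_toD[OF projectableD(4)[OF E]])
    note s = smooth_fun_comp_fst[OF A A' h] smooth_fun_comp_snd[OF A A' h'] b
    \<comment> \<open>Nesting the product as \<open>b (b h')\<close> lets the binary Leibniz rule apply twice.\<close>
    have "metric_fun ?g F G = (\<lambda>q. (?h \<circ> fst) q + b q * (b q * (?h' \<circ> snd) q))"
      using metric_fun_twisted[OF projectableD(4)[OF F] projectableD(4)[OF G], of g g' b]
      by (simp add: fun_eq_iff power2_eq_square mult.assoc)
    then have "E p (metric_fun ?g F G) = E p (?h \<circ> fst)
        + (b p * (b p * E p (?h' \<circ> snd) + (?h' \<circ> snd) p * E p b) + b p * (?h' \<circ> snd) p * E p b)"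
      using s by (simp add: tangent_add[OF t] tangent_mult[OF t] smooth_fun_mult[OF AA] del: comp_apply)
    then show ?thesis
      by (simp add: vf_apply_def h_proj h'_proj power2_eq_square algebra_simps)
  qed
  have bracket: "metric_fun ?g E (lie_bracket F G) p
      = metric_fun g X (lie_bracket Y Z) (fst p) + (b p)\<^sup>2 * metric_fun g' U (lie_bracket V W) (snd p)"
    if "projectable A A' E X U" "projectable A A' F Y V" "projectable A A' G Z W"
    for E F G X Y Z U V W
    using that by (intro metric_fun_twisted lie_bracket_projects_to[OF A A'] projectableD(4))
  show ?thesis
    unfolding koszul_def
    by (simp add: deriv[OF E\<^sub>1 E\<^sub>2 E\<^sub>3] deriv[OF E\<^sub>2 E\<^sub>3 E\<^sub>1] deriv[OF E\<^sub>3 E\<^sub>1 E\<^sub>2] bracket[OF E\<^sub>1 E\<^sub>2 E\<^sub>3]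
        bracket[OF E\<^sub>2 E\<^sub>3 E\<^sub>1] bracket[OF E\<^sub>3 E\<^sub>1 E\<^sub>2] field_simps)
qed

theorem proposition5p8:
  fixes A\<^sub>B :: "('b::{t2_space, second_countable_topology}, 'e::real_normed_vector) atlas"
    and A\<^sub>F :: "('f::{t2_space, second_countable_topology}, 'h::real_normed_vector) atlas"
    and g\<^sub>B :: "'b metric" and g\<^sub>F :: "'f metric"
    and b :: "'b \<times> 'f \<Rightarrow> real"
    and P U V W :: "'f vfield" and X Y Z :: "'b vfield"
  defines "K \<equiv> semi_symmetric_koszul (twisted_metric A\<^sub>B g\<^sub>B A\<^sub>F g\<^sub>F b) (lift_fibre A\<^sub>B A\<^sub>F P)"
    and "LB \<equiv> lift_base A\<^sub>B A\<^sub>F"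
    and "LF \<equiv> lift_fibre A\<^sub>B A\<^sub>F"
  assumes "singular_semi_riemannian A\<^sub>B g\<^sub>B"
    and "singular_semi_riemannian A\<^sub>F g\<^sub>F"
    and "smooth_fun (prod_atlas A\<^sub>B A\<^sub>F) b"
    and "P \<in> vector_fields A\<^sub>F"
    and "X \<in> vector_fields A\<^sub>B" "Y \<in> vector_fields A\<^sub>B" "Z \<in> vector_fields A\<^sub>B"
    and "U \<in> vector_fields A\<^sub>F" "V \<in> vector_fields A\<^sub>F" "W \<in> vector_fields A\<^sub>F"
  shows "(\<forall>x y. K (LB X) (LB Y) (LB Z) (x, y) = koszul g\<^sub>B X Y Z x)
       \<and> (\<forall>x y. K (LB X) (LB Y) (LF W) (x, y) = - K (LB X) (LF W) (LB Y) (x, y) \<and>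
           - K (LB X) (LF W) (LB Y) (x, y)
             = - ((b (x, y))\<^sup>2 * metric_fun g\<^sub>B X Y x * metric_fun g\<^sub>F P W y))
       \<and> (\<forall>x y. K (LF W) (LB X) (LB Y) (x, y) = 0)
       \<and> (\<forall>x y. K (LB X) (LF V) (LF W) (x, y) = K (LF V) (LB X) (LF W) (x, y) \<and>
           K (LF V) (LB X) (LF W) (x, y) = - K (LF V) (LF W) (LB X) (x, y) \<and>
           - K (LF V) (LF W) (LB X) (x, y)
             = b (x, y) * vf_apply (LB X) b (x, y) * metric_fun g\<^sub>F V W y)
       \<and> (\<forall>x y. K (LF U) (LF V) (LF W) (x, y) =
             b (x, y) * vf_apply (LF U) b (x, y) * metric_fun g\<^sub>F V W y
           + b (x, y) * vf_apply (LF V) b (x, y) * metric_fun g\<^sub>F W U y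
           - b (x, y) * vf_apply (LF W) b (x, y) * metric_fun g\<^sub>F U V y
           + (b (x, y))\<^sup>2 * koszul g\<^sub>F U V W y
           + (b (x, y))^4 * metric_fun g\<^sub>F V P y * metric_fun g\<^sub>F U W y
           - (b (x, y))^4 * metric_fun g\<^sub>F W P y * metric_fun g\<^sub>F U V y)"
proof -
  note gB = assms(4) and gF = assms(5) and b = assms(6)
  note B = singular_covering_atlas[OF gB] and F = singular_covering_atlas[OF gF]
  note zB = zero_field_vector_field[OF B] and zF = zero_field_vector_field[OF F]
  note lifts = assms(8-10)[THEN projectable_lift_base[OF B F]]
    assms(7,11-13)[THEN projectable_lift_fibre[OF B F]]
  \<comment> \<open>Since \<open>P\<close> is a fibre field, only the fibre part of each metric value against \<open>P\<close> survives.\<close>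
  have K: "K E\<^sub>1 E\<^sub>2 E\<^sub>3 (x, y) = koszul g\<^sub>B X Y Z x + (b (x, y))\<^sup>2 * koszul g\<^sub>F U V W y
      + b (x, y) * vf_apply E\<^sub>1 b (x, y) * metric_fun g\<^sub>F V W y
      + b (x, y) * vf_apply E\<^sub>2 b (x, y) * metric_fun g\<^sub>F W U y
      - b (x, y) * vf_apply E\<^sub>3 b (x, y) * metric_fun g\<^sub>F U V y
      + (b (x, y))\<^sup>2 * metric_fun g\<^sub>F V P y * (metric_fun g\<^sub>B X Z x + (b (x, y))\<^sup>2 * metric_fun g\<^sub>F U W y)
      - (metric_fun g\<^sub>B X Y x + (b (x, y))\<^sup>2 * metric_fun g\<^sub>F U V y) * ((b (x, y))\<^sup>2 * metric_fun g\<^sub>F W P y)"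
    if E: "projectable A\<^sub>B A\<^sub>F E\<^sub>1 X U" "projectable A\<^sub>B A\<^sub>F E\<^sub>2 Y V" "projectable A\<^sub>B A\<^sub>F E\<^sub>3 Z W"
    for E\<^sub>1 E\<^sub>2 E\<^sub>3 X Y Z U V W x y
  proof -
    have metric: "metric_fun (twisted_metric A\<^sub>B g\<^sub>B A\<^sub>F g\<^sub>F b) E\<^sub>1' E\<^sub>2' (x, y)
        = metric_fun g\<^sub>B X' Y' x + (b (x, y))\<^sup>2 * metric_fun g\<^sub>F U' V' y"
      if "projectable A\<^sub>B A\<^sub>F E\<^sub>1' X' U'" "projectable A\<^sub>B A\<^sub>F E\<^sub>2' Y' V'" for E\<^sub>1' E\<^sub>2' X' Y' U' V'
      using metric_fun_twisted[OF projectableD(4)[OF that(1)] projectableD(4)[OF that(2)]] by simp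
    note P = projectable_lift_fibre[OF B F assms(7)]
    note Y = projectableD(1)[OF E(2)] and Z = projectableD(1)[OF E(3)] and W = projectableD(2)[OF E(3)]
    show ?thesis
      unfolding K_def semi_symmetric_koszul_def koszul_twisted_projectable[OF gB gF b E]
        metric[OF E(1,2)] metric[OF E(1,3)] metric[OF E(2) P] metric[OF P E(3)]
        metric_fun_zero[OF gB Y] metric_fun_zero[OF gB Z]
        metric_fun_sym[OF gF assms(7) W]
      by simp
  qed
  note zero = koszul_zero[OF gB] koszul_zero[OF gF]
    metric_fun_zero[OF gB] metric_fun_zero[OF gF]
  note fields = assms(7-13) zB zF
  show ?thesis
    unfolding LB_def LF_def
    by (simp add: K[OF lifts(1) lifts(2) lifts(3)] K[OF lifts(1) lifts(2) lifts(7)]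
        K[OF lifts(1) lifts(7) lifts(2)] K[OF lifts(7) lifts(1) lifts(2)]
        K[OF lifts(1) lifts(6) lifts(7)] K[OF lifts(6) lifts(1) lifts(7)]
        K[OF lifts(6) lifts(7) lifts(1)] K[OF lifts(5) lifts(6) lifts(7)]
        zero fields metric_fun_sym[OF gF assms(7)] metric_fun_sym[OF gF assms(13) assms(12)]
        power2_eq_square power4_eq_xxxx algebra_simps)
qed

end
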